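(* Let $(X,\Sigma_X)$, $(Y,\Sigma_Y)$ be measurable spaces, $p\ge 1$, and $\mathcal{Z}:=X\times Y\times\{0,\dots,p\}$. Let $\mathcal{V}_0,\dots,\mathcal{V}_p:X\times\Sigma_Y\to[0,1]$ be Markov kernels, $S_0,\dots,S_p:X\times Y\to X\times Y$ measurable mappings, and $\alpha_{k,j}:X\times Y\to[0,1]$, $k,j=0,\dots,p$, measurable functions. Let $\mu$ be a probability measure on $X$ and define probability measures $\mathcal{M}_j(dq,dv)=\mathcal{V}_j(q,dv)\,\mu(dq)$ on $X\times Y$, $j=0,\dots,p$. Assume that (H1) $S_j\circ S_j=I$ for $j=0,1,\dots,p$; and (H2) $\sum_{j=0}^p\alpha_{k,j}(q,v)=1$ for all $k=0,\dots,p$ and $(q,v)\in X\times Y$, and $$S_j^*\mathcal{M}_j(dq,dv)=\sum_{k=0}^p\alpha_{k,j}(q,v)\,S_k^*\mathcal{M}_k(dq,dv)\quad\text{for each }j=0,\dots,p.$$ Let $\mathcal{R},\mathcal{A},\mathcal{P}_n$ ($n\ge 1$) be the Markov kernels on $\mathcal{Z}$, $\mathcal{E}:\mathcal{Z}\to X$ the map, and $\mathcal{N}$ the probability measure on $\mathcal{Z}$, defined in the context from $(\mathcal{V}_j)_j$, $(S_j)_j$, $(\alpha_{k,j})_{k,j}$ and $\mu$. Then: (i) $\mathcal{N}$ is invariant under $\mathcal{R}$; (ii) $\mathcal{N}$ is invariant under $\mathcal{A}$; (iii) $\mathcal{N}$ is invariant under $\mathcal{P}_n$ for every $n\ge 1$;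 (iv) $\mathcal{E}^*\mathcal{N}=\mu$, and therefore $\mathcal{E}^*(\mathcal{N}\mathcal{P}_n)=\mu$ for every $n\ge 1$.
   Context: $\Pi_1:X\times Y\to X$ is the projection $\Pi_1(q,v)=q$. $\phi^*\nu$ denotes the pushforward of a measure $\nu$ by $\phi$: $\phi^*\nu(E)=\nu(\phi^{-1}(E))$. A Markov kernel $\mathcal V_j:X\times\Sigma_Y\to[0,1]$ is a probability measure in its second argument and measurable in its first. For a kernel $K$ and a measure $\nu$ on $\mathcal{Z}$, $\nu K(d\tilde z)=\int_{\mathcal{Z}}K(z,d\tilde z)\,\nu(dz)$, and $\nu$ is invariant under $K$ if $\nu K=\nu$. Definitions: $\mathcal{R}(q,v,k,d\tilde q,d\tilde v,d\tilde k)=S_k^*\big(\mathcal{V}_k(\Pi_1S_k(q,v),d\tilde v)\,\delta_{\Pi_1S_k(q,v)}(d\tilde q)\big)\,\delta_k(d\tilde k)$, i.e. the $(\tilde q,\tilde v)$-component is the pushforward by $S_k$ of the product measure $\delta_{\Pi_1S_k(q,v)}(d\tilde q)\,\mathcal{V}_k(\Pi_1S_k(q,v),d\tilde v)$ on $X\times Y$. $\mathcal{A}(q,v,k,d\tilde q,d\tilde v,d\tilde k)=\delta_{(q,v)}(d\tilde q,d\tilde v)\sum_{j=0}^p\alpha_{k,j}(q,v)\,\delta_j(d\tilde k)$. $\mathcal{P}_1(z,d\tilde z)=\mathcal{R}\mathcal{A}(z,d\tilde z)=\int_{\mathcal{Z}}\mathcal{A}(\hat z,d\tilde z)\,\mathcal{R}(z,d\hat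 z)$, and for $n\ge 2$, $\mathcal{P}_n(z,d\tilde z)=\mathcal{P}_{n-1}\mathcal{A}(z,d\tilde z)=\int_{\mathcal{Z}}\mathcal{A}(\hat z,d\tilde z)\,\mathcal{P}_{n-1}(z,d\hat z)$. $\mathcal{E}(q,v,k)=\Pi_1S_k(q,v)$. $\mathcal{N}(d\tilde q,d\tilde v,d\tilde k)=\sum_{j=0}^p\frac{1}{p+1}\,S_j^*\mathcal{M}_j(d\tilde q,d\tilde v)\,\delta_j(d\tilde k)$. *)

theory Defs
  imports "HOL-Probability.Probability"
begin

text \<open>
  A measurable space is represented by a value of type \<^typ>\<open>'a measure\<close> of which only
  \<^const>\<open>space\<close> and \<^const>\<open>sets\<close> matter. A Markov kernel from \<open>M\<close> to \<open>N\<close> is a measurable map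
  \<open>K \<in> M \<rightarrow>\<^sub>M prob_algebra N\<close>, the pushforward of \<open>\<nu>\<close> by \<open>\<phi>\<close> is \<open>distr \<nu> N \<phi>\<close>, the Dirac measure
  is \<^const>\<open>return\<close>, and \<open>\<nu>K\<close> is \<open>\<nu> \<bind> K\<close>. The measure \<open>f(z) \<nu>(dz)\<close> is \<open>density \<nu> f\<close>.
\<close>

text \<open>
  The finite sum of measures on the measurable space \<open>M\<close>. The summands are meant to have the
  \<open>\<sigma>\<close>-algebra of \<open>M\<close>; see \<open>emeasure_measure_sum\<close> below.
\<close>

definition measure_sum :: "'a measure \<Rightarrow> 'i set \<Rightarrow> ('i \<Rightarrow> 'a measure) \<Rightarrow> 'a measure" where
  "measure_sum M I N = measure_of (space M) (sets M) (\<lambda>E. \<Sum>i\<in>I. emeasure (N i) E)"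

lemma sets_measure_sum [simp, measurable_cong]: "sets (measure_sum M I N) = sets M"
  by (simp add: measure_sum_def)

lemma space_measure_sum [simp]: "space (measure_sum M I N) = space M"
  by (simp add: measure_sum_def)

lemma emeasure_measure_sum:
  fixes M :: "'a measure"
  assumes "\<And>i. i \<in> I \<Longrightarrow> sets (N i) = sets M" and E: "E \<in> sets M"
  shows "emeasure (measure_sum M I N) E = (\<Sum>i\<in>I. emeasure (N i) E)"
proof (rule emeasure_measure_of[OF measure_sum_def])
  show "sets M \<subseteq> Pow (space M)" by (rule sets.space_closed)
  show "positive (sets (measure_sum M I N)) (\<lambda>E. \<Sum>i\<in>I. emeasure (N i) E)"
    by (simp add: positive_def)
  show "countably_additive (sets (measure_sum M I N)) (\<lambda>E. \<Sum>i\<in>I. emeasure (N i) E)"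
  proof (rule countably_additiveI)
    fix A :: "nat \<Rightarrow> 'a set"
    assume A: "range A \<subseteq> sets (measure_sum M I N)" "disjoint_family A"
    have "(\<Sum>n. \<Sum>i\<in>I. emeasure (N i) (A n)) = (\<Sum>i\<in>I. \<Sum>n. emeasure (N i) (A n))"
      by (rule suminf_sum) simp
    also have "\<dots> = (\<Sum>i\<in>I. emeasure (N i) (\<Union>n. A n))"
      using A assms(1) by (intro sum.cong refl suminf_emeasure) auto
    finally show "(\<Sum>n. \<Sum>i\<in>I. emeasure (N i) (A n)) = (\<Sum>i\<in>I. emeasure (N i) (\<Union>n. A n))" .
  qed
  show "E \<in> sets (measure_sum M I N)" using E by simp
qed

text \<open>
  The points \<open>(q, v, k)\<close> of \<open>\<Z>\<close> are written \<open>((q, v), k)\<close>, so that the \<open>(q, v)\<close>-component is an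
  element of \<open>X \<Otimes>\<^sub>M Y\<close>.
\<close>

definition Zspace :: "'a measure \<Rightarrow> 'b measure \<Rightarrow> nat \<Rightarrow> (('a \<times> 'b) \<times> nat) measure" where
  "Zspace X Y p = (X \<Otimes>\<^sub>M Y) \<Otimes>\<^sub>M count_space {..p}"

definition Mmeas ::
  "'a measure \<Rightarrow> 'a measure \<Rightarrow> (nat \<Rightarrow> 'a \<Rightarrow> 'b measure) \<Rightarrow> nat \<Rightarrow> ('a \<times> 'b) measure" where
  "Mmeas X \<mu> V j = \<mu> \<bind> (\<lambda>q. return X q \<Otimes>\<^sub>M V j q)"

definition Rker ::
  "'a measure \<Rightarrow> 'b measure \<Rightarrow> nat \<Rightarrow> (nat \<Rightarrow> 'a \<Rightarrow> 'b measure)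
    \<Rightarrow> (nat \<Rightarrow> 'a \<times> 'b \<Rightarrow> 'a \<times> 'b) \<Rightarrow> ('a \<times> 'b) \<times> nat \<Rightarrow> (('a \<times> 'b) \<times> nat) measure" where
  "Rker X Y p V S = (\<lambda>((q, v), k).
     distr (return X (fst (S k (q, v))) \<Otimes>\<^sub>M V k (fst (S k (q, v)))) (X \<Otimes>\<^sub>M Y) (S k)
       \<Otimes>\<^sub>M return (count_space {..p}) k)"

definition Aker ::
  "'a measure \<Rightarrow> 'b measure \<Rightarrow> nat \<Rightarrow> (nat \<Rightarrow> nat \<Rightarrow> 'a \<times> 'b \<Rightarrow> real)
    \<Rightarrow> ('a \<times> 'b) \<times> nat \<Rightarrow> (('a \<times> 'b) \<times> nat) measure" where
  "Aker X Y p \<alpha> = (\<lambda>((q, v), k).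
     return (X \<Otimes>\<^sub>M Y) (q, v) \<Otimes>\<^sub>M
       measure_sum (count_space {..p}) {..p}
         (\<lambda>j. scale_measure (ennreal (\<alpha> k j (q, v))) (return (count_space {..p}) j)))"

text \<open>Only the indices \<open>n \<ge> 1\<close> are of interest; the value \<open>\<R>\<close> at \<open>0\<close> makes \<open>\<P>\<^sub>1 = \<R>\<A>\<close>.\<close>

primrec Pker ::
  "'a measure \<Rightarrow> 'b measure \<Rightarrow> nat \<Rightarrow> (nat \<Rightarrow> 'a \<Rightarrow> 'b measure)
    \<Rightarrow> (nat \<Rightarrow> 'a \<times> 'b \<Rightarrow> 'a \<times> 'b) \<Rightarrow> (nat \<Rightarrow> nat \<Rightarrow> 'a \<times> 'b \<Rightarrow> real)
    \<Rightarrow> nat \<Rightarrow> ('a \<times> 'b) \<times> nat \<Rightarrow> (('a \<times> 'b) \<times> nat) measure" where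
  "Pker X Y p V S \<alpha> 0 = Rker X Y p V S"
| "Pker X Y p V S \<alpha> (Suc n) = (\<lambda>z. Pker X Y p V S \<alpha> n z \<bind> Aker X Y p \<alpha>)"

definition Emap :: "(nat \<Rightarrow> 'a \<times> 'b \<Rightarrow> 'a \<times> 'b) \<Rightarrow> ('a \<times> 'b) \<times> nat \<Rightarrow> 'a" where
  "Emap S = (\<lambda>((q, v), k). fst (S k (q, v)))"

definition Nmeas ::
  "'a measure \<Rightarrow> 'b measure \<Rightarrow> nat \<Rightarrow> 'a measure \<Rightarrow> (nat \<Rightarrow> 'a \<Rightarrow> 'b measure)
    \<Rightarrow> (nat \<Rightarrow> 'a \<times> 'b \<Rightarrow> 'a \<times> 'b) \<Rightarrow> (('a \<times> 'b) \<times> nat) measure" where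
  "Nmeas X Y p \<mu> V S = measure_sum (Zspace X Y p) {..p}
     (\<lambda>j. scale_measure (ennreal (1 / (real p + 1)))
        (distr (Mmeas X \<mu> V j) (X \<Otimes>\<^sub>M Y) (S j) \<Otimes>\<^sub>M return (count_space {..p}) j))"

text \<open>
  \<^const>\<open>bind\<close> and \<^const>\<open>distr\<close> have their intended meaning only for measurable maps, so we check
  that the objects above are probability measures and Markov kernels.
\<close>

lemma Mmeas_prob:
  assumes "prob_space \<mu>" "sets \<mu> = sets X" and [measurable]: "V j \<in> X \<rightarrow>\<^sub>M prob_algebra Y"
  shows "Mmeas X \<mu> V j \<in> space (prob_algebra (X \<Otimes>\<^sub>M Y))"
proof -
  have [measurable]: "(\<lambda>q. return X q \<Otimes>\<^sub>M V j q) \<in> \<mu> \<rightarrow>\<^sub>M prob_algebra (X \<Otimes>\<^sub>M Y)"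
    unfolding measurable_cong_sets[OF assms(2) refl] by measurable
  have "\<mu> \<in> space (prob_algebra \<mu>)"
    using assms(1) by (simp add: space_prob_algebra)
  then show ?thesis
    unfolding Mmeas_def
    using assms(1) prob_space_bind'[of \<mu> \<mu> "\<lambda>q. return X q \<Otimes>\<^sub>M V j q" "X \<Otimes>\<^sub>M Y"]
      sets_bind'[of \<mu> \<mu> "\<lambda>q. return X q \<Otimes>\<^sub>M V j q" "X \<Otimes>\<^sub>M Y"]
    by (simp add: space_prob_algebra)
qed

lemma emeasure_Mmeas:
  assumes "prob_space \<mu>" "sets \<mu> = sets X" and V [measurable]: "V j \<in> X \<rightarrow>\<^sub>M prob_algebra Y"
    and E: "E \<in> sets (X \<Otimes>\<^sub>M Y)"
  shows "emeasure (Mmeas X \<mu> V j) E = (\<integral>\<^sup>+q. emeasure (V j q) (Pair q -` E) \<partial>\<mu>)"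
proof -
  have "\<mu> \<in> space (prob_algebra X)"
    using assms(1,2) by (simp add: space_prob_algebra)
  then have "emeasure (Mmeas X \<mu> V j) E = (\<integral>\<^sup>+q. emeasure (return X q \<Otimes>\<^sub>M V j q) E \<partial>\<mu>)"
    unfolding Mmeas_def using E
    by (intro emeasure_bind_prob_algebra[where N=X]) auto
  also have "\<dots> = (\<integral>\<^sup>+q. emeasure (V j q) (Pair q -` E) \<partial>\<mu>)"
  proof (rule nn_integral_cong)
    fix q assume "q \<in> space \<mu>"
    then have q: "q \<in> space X" using sets_eq_imp_space_eq[OF assms(2)] by simp
    then have Vq: "V j q \<in> space (prob_algebra Y)" by (rule measurable_space[OF V])
    then interpret V: prob_space "V j q" by (simp add: space_prob_algebra)
    have sV [measurable_cong]: "sets (V j q) = sets Y" using Vq by (simp add: space_prob_algebra)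
    have E': "E \<in> sets (X \<Otimes>\<^sub>M V j q)" using E by (simp add: sV cong: sets_pair_measure_cong)
    have "emeasure (return X q \<Otimes>\<^sub>M V j q) E
      = (\<integral>\<^sup>+x. emeasure (V j q) (Pair x -` E) \<partial>return X q)"
      using E' by (intro V.emeasure_pair_measure_alt) (simp cong: sets_pair_measure_cong)
    also have "\<dots> = emeasure (V j q) (Pair q -` E)"
      using q E' by (intro nn_integral_return V.measurable_emeasure_Pair)
    finally show "emeasure (return X q \<Otimes>\<^sub>M V j q) E = emeasure (V j q) (Pair q -` E)" .
  qed
  finally show ?thesis .
qed

lemma measurable_Zspace_split:
  assumes "\<And>k. k \<le> p \<Longrightarrow> (\<lambda>x. f (x, k)) \<in> X \<Otimes>\<^sub>M Y \<rightarrow>\<^sub>M N"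
  shows "f \<in> Zspace X Y p \<rightarrow>\<^sub>M N"
  unfolding Zspace_def measurable_pair_swap_iff[of f] using assms
  by (intro measurable_pair_measure_countable1) auto

lemma Rker_measurable:
  assumes V: "\<And>j. j \<le> p \<Longrightarrow> V j \<in> X \<rightarrow>\<^sub>M prob_algebra Y"
    and S: "\<And>j. j \<le> p \<Longrightarrow> S j \<in> X \<Otimes>\<^sub>M Y \<rightarrow>\<^sub>M X \<Otimes>\<^sub>M Y"
  shows "Rker X Y p V S \<in> Zspace X Y p \<rightarrow>\<^sub>M prob_algebra (Zspace X Y p)"
proof (rule measurable_Zspace_split)
  fix k assume k: "k \<le> p"
  note [measurable] = V[OF k] S[OF k]
  have [measurable]: "k \<in> space (count_space {..p})" using k by simp
  show "(\<lambda>x. Rker X Y p V S (x, k)) \<in> X \<Otimes>\<^sub>M Y \<rightarrow>\<^sub>M prob_algebra (Zspace X Y p)"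
    unfolding Rker_def Zspace_def split_beta prod.collapse fst_conv snd_conv by measurable
qed

lemma Aker_measurable:
  assumes \<alpha>: "\<And>k j. k \<le> p \<Longrightarrow> j \<le> p \<Longrightarrow> \<alpha> k j \<in> borel_measurable (X \<Otimes>\<^sub>M Y)"
    and \<alpha>0: "\<And>k j x. k \<le> p \<Longrightarrow> j \<le> p \<Longrightarrow> x \<in> space (X \<Otimes>\<^sub>M Y) \<Longrightarrow> 0 \<le> \<alpha> k j x"
    and \<alpha>1: "\<And>k x. k \<le> p \<Longrightarrow> x \<in> space (X \<Otimes>\<^sub>M Y) \<Longrightarrow> (\<Sum>j\<le>p. \<alpha> k j x) = 1"
  shows "Aker X Y p \<alpha> \<in> Zspace X Y p \<rightarrow>\<^sub>M prob_algebra (Zspace X Y p)"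
proof (rule measurable_Zspace_split)
  fix k assume k: "k \<le> p"
  let ?C = "count_space {..p}"
  let ?s = "\<lambda>x. measure_sum ?C {..p} (\<lambda>j. scale_measure (ennreal (\<alpha> k j x)) (return ?C j))"
  have em: "emeasure (?s x) E = (\<Sum>j\<le>p. ennreal (\<alpha> k j x) * indicator E j)" if "E \<subseteq> {..p}" for x E
    using that by (subst emeasure_measure_sum) auto
  have ps: "prob_space (?s x)" if x: "x \<in> space (X \<Otimes>\<^sub>M Y)" for x
  proof (rule prob_spaceI)
    have "(\<Sum>j\<le>p. ennreal (\<alpha> k j x)) = ennreal (\<Sum>j\<le>p. \<alpha> k j x)"
      using k x \<alpha>0 by (intro sum_ennreal) auto
    then show "emeasure (?s x) (space (?s x)) = 1"
      using \<alpha>1[OF k x] by (simp add: em)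
  qed
  have s [measurable]: "?s \<in> X \<Otimes>\<^sub>M Y \<rightarrow>\<^sub>M prob_algebra ?C"
  proof (rule measurable_prob_algebraI)
    fix x assume "x \<in> space (X \<Otimes>\<^sub>M Y)"
    then show "prob_space (?s x)" by (rule ps)
  next
    show "?s \<in> X \<Otimes>\<^sub>M Y \<rightarrow>\<^sub>M subprob_algebra ?C"
    proof (rule measurable_subprob_algebra)
      fix x assume x: "x \<in> space (X \<Otimes>\<^sub>M Y)"
      show "subprob_space (?s x)"
        by (intro prob_space_imp_subprob_space ps x)
    next
      fix E assume "E \<in> sets ?C"
      then show "(\<lambda>x. emeasure (?s x) E) \<in> borel_measurable (X \<Otimes>\<^sub>M Y)"
        using \<alpha>[OF k] by (simp add: em)
    qed simp
  qed
  show "(\<lambda>x. Aker X Y p \<alpha> (x, k)) \<in> X \<Otimes>\<^sub>M Y \<rightarrow>\<^sub>M prob_algebra (Zspace X Y p)"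
    unfolding Aker_def Zspace_def split_beta prod.collapse fst_conv snd_conv by measurable
qed

lemma Pker_measurable:
  assumes "Rker X Y p V S \<in> Zspace X Y p \<rightarrow>\<^sub>M prob_algebra (Zspace X Y p)"
    and "Aker X Y p \<alpha> \<in> Zspace X Y p \<rightarrow>\<^sub>M prob_algebra (Zspace X Y p)"
  shows "Pker X Y p V S \<alpha> n \<in> Zspace X Y p \<rightarrow>\<^sub>M prob_algebra (Zspace X Y p)"
  using assms by (induction n) (auto intro: measurable_bind_prob_space)

lemma Nmeas_prob:
  assumes "prob_space \<mu>" "sets \<mu> = sets X"
    and V: "\<And>j. j \<le> p \<Longrightarrow> V j \<in> X \<rightarrow>\<^sub>M prob_algebra Y"
    and S: "\<And>j. j \<le> p \<Longrightarrow> S j \<in> X \<Otimes>\<^sub>M Y \<rightarrow>\<^sub>M X \<Otimes>\<^sub>M Y"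
  shows "Nmeas X Y p \<mu> V S \<in> space (prob_algebra (Zspace X Y p))"
proof -
  let ?D = "\<lambda>j. distr (Mmeas X \<mu> V j) (X \<Otimes>\<^sub>M Y) (S j) \<Otimes>\<^sub>M return (count_space {..p}) j"
  have s: "sets (?D j) = sets (Zspace X Y p)" for j
    unfolding Zspace_def by (intro sets_pair_measure_cong) auto
  have one: "emeasure (?D j) (space (Zspace X Y p)) = 1" if "j \<le> p" for j
  proof -
    have M: "Mmeas X \<mu> V j \<in> space (prob_algebra (X \<Otimes>\<^sub>M Y))"
      using assms(1,2) V[OF that] by (rule Mmeas_prob)
    have "S j \<in> Mmeas X \<mu> V j \<rightarrow>\<^sub>M X \<Otimes>\<^sub>M Y"
      using M S[OF that] by (simp add: space_prob_algebra cong: measurable_cong_sets)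
    then have "prob_space (distr (Mmeas X \<mu> V j) (X \<Otimes>\<^sub>M Y) (S j))"
      using M by (intro prob_space.prob_space_distr) (auto simp: space_prob_algebra)
    then have "prob_space (?D j)"
      using that by (intro prob_space_pair prob_space_return) auto
    then show ?thesis
      using prob_space.emeasure_space_1 sets_eq_imp_space_eq[OF s[of j]] by metis
  qed
  have "emeasure (Nmeas X Y p \<mu> V S) (space (Zspace X Y p))
      = (\<Sum>j\<le>p. ennreal (1 / (real p + 1)) * emeasure (?D j) (space (Zspace X Y p)))"
    unfolding Nmeas_def by (subst emeasure_measure_sum) (auto simp: s)
  also have "\<dots> = (\<Sum>j\<le>p. ennreal (1 / (real p + 1)))"
    by (intro sum.cong) (auto simp: one)
  also have "\<dots> = ennreal (\<Sum>j\<le>p. 1 / (real p + 1))"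
    by (rule sum_ennreal) simp
  also have "\<dots> = 1" by simp
  finally show ?thesis
    by (auto simp: space_prob_algebra Nmeas_def intro!: prob_spaceI)
qed

end

theory Submission
  imports Defs
begin

text \<open>
  Transport \<open>\<N>\<close> by the involutions: under \<open>S\<^sub>k\<close> the slice \<open>k\<close> of \<open>\<N>\<close> becomes \<open>\<M>\<^sub>k / (p + 1)\<close>, and
  \<open>\<Pi>\<^sub>1 S\<^sub>k S\<^sub>k (q, v) = q\<close>. Hence \<open>\<E>\<close> becomes the projection \<open>\<Pi>\<^sub>1\<close>, whose image of \<open>\<M>\<^sub>k\<close> is \<open>\<mu>\<close>, and
  \<open>\<R>\<close> resamples \<open>v\<close> from \<open>\<V>\<^sub>k(q, \<cdot>)\<close>, which preserves \<open>\<M>\<^sub>k\<close>. Invariance under \<open>\<A>\<close> is (H2) after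
  exchanging the sums over \<open>k\<close> and \<open>j\<close>.
\<close>

section \<open>Integration against finite sums of measures and against products with a Dirac
  factor\<close>

text \<open>\<open>measure_sum\<close> is known only through its values on measurable sets, so the
  formula is lifted from indicators by induction over nonnegative measurable functions. Equality of
  the sigma-algebras carries measurability from \<open>M\<close> over to each
  \<open>N i\<close>.\<close>

lemma nn_integral_measure_sum:
  assumes sets_N: "\<And>i. i \<in> I \<Longrightarrow> sets (N i) = sets M"
    and f: "f \<in> borel_measurable M"
  shows "(\<integral>\<^sup>+x. f x \<partial>measure_sum M I N) = (\<Sum>i\<in>I. \<integral>\<^sup>+x. f x \<partial>N i)"
  using f
proof (induction rule: borel_measurable_induct)
  case (cong f g)
  have "(\<integral>\<^sup>+x. f x \<partial>measure_sum M I N) = (\<integral>\<^sup>+x. g x \<partial>measure_sum M I N)"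
    using cong(3) by (intro nn_integral_cong) auto
  \<comment> \<open>\<open>f\<close> and \<open>g\<close> agree on \<open>space M\<close> only; this
    is also the space of \<open>N i\<close>, since the sigma-algebras coincide.\<close>
  moreover have "(\<integral>\<^sup>+x. f x \<partial>N i) = (\<integral>\<^sup>+x. g x \<partial>N i)" if "i \<in> I" for i
    using cong(3) sets_eq_imp_space_eq[OF sets_N[OF that]] by (intro nn_integral_cong) auto
  ultimately show ?case
    using cong(4) by simp
next
  case (set A)
  then show ?case
    by (simp add: emeasure_measure_sum sets_N)
next
  case (mult u c)
  then show ?case
    by (simp add: nn_integral_cmult sets_N sum_distrib_left cong: measurable_cong_sets)
next
  case (add u v)
  then show ?case
    by (simp add: nn_integral_add sets_N sum.distrib cong: measurable_cong_sets)
next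
  case (seq U)
  have U: "U n \<in> borel_measurable (N i)" if "i \<in> I" for i n
    using seq(1) sets_N[OF that] by (simp cong: measurable_cong_sets)
  \<comment> \<open>Monotonicity in \<open>n\<close> is what lets the supremum pass through the sum
    over \<open>I\<close> below.\<close>
  have inc: "incseq (\<lambda>n. integral\<^sup>N L (U n))" for L
    using seq(3) by (auto simp: mono_def le_fun_def intro!: nn_integral_mono)
  have "(\<integral>\<^sup>+x. (SUP n. U n x) \<partial>measure_sum M I N) = (SUP n. integral\<^sup>N (measure_sum M I N) (U n))"
    using seq(1,3) by (intro nn_integral_monotone_convergence_SUP) auto
  also have "\<dots> = (SUP n. \<Sum>i\<in>I. integral\<^sup>N (N i) (U n))"
    using seq.IH by simp
  also have "\<dots> = (\<Sum>i\<in>I. SUP n. integral\<^sup>N (N i) (U n))"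
    using inc by (intro ennreal_SUP_sum)
  also have "\<dots> = (\<Sum>i\<in>I. \<integral>\<^sup>+x. (SUP n. U n x) \<partial>N i)"
    using U seq(3)
    by (intro sum.cong refl nn_integral_monotone_convergence_SUP[symmetric]) auto
  finally show ?case
    by (simp add: image_comp)
qed

text \<open>Tonelli's theorem asks for sigma-finiteness of the second factor. Here this is the Dirac
  measure, a probability measure because \<open>j\<close> lies in \<open>space C\<close>.\<close>

lemma nn_integral_pair_return:
  assumes "j \<in> space C" and f: "f \<in> borel_measurable (N \<Otimes>\<^sub>M C)"
  shows "(\<integral>\<^sup>+z. f z \<partial>(N \<Otimes>\<^sub>M return C j)) = (\<integral>\<^sup>+x. f (x, j) \<partial>N)"
proof -
  interpret prob_space "return C j"
    using assms(1) by (rule prob_space_return)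
  have "sets (N \<Otimes>\<^sub>M return C j) = sets (N \<Otimes>\<^sub>M C)"
    by (intro sets_pair_measure_cong) auto
  then have f': "f \<in> borel_measurable (N \<Otimes>\<^sub>M return C j)"
    using f by (simp cong: measurable_cong_sets)
  have "(\<integral>\<^sup>+z. f z \<partial>(N \<Otimes>\<^sub>M return C j)) = (\<integral>\<^sup>+x. \<integral>\<^sup>+k. f (x, k) \<partial>return C j \<partial>N)"
    using f' by (rule nn_integral_fst[symmetric])
  also have "\<dots> = (\<integral>\<^sup>+x. f (x, j) \<partial>N)"
    using assms by (intro nn_integral_cong nn_integral_return) auto
  finally show ?thesis .
qed

text \<open>Mirror image of the previous lemma. The second factor is now \<open>N\<close>, which is
  why its sigma-finiteness is assumed.\<close>

lemma nn_integral_return_pair: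
  assumes "sigma_finite_measure N" "q \<in> space X" and f: "f \<in> borel_measurable (X \<Otimes>\<^sub>M N)"
  shows "(\<integral>\<^sup>+z. f z \<partial>(return X q \<Otimes>\<^sub>M N)) = (\<integral>\<^sup>+v. f (q, v) \<partial>N)"
proof -
  interpret sigma_finite_measure N by fact
  have "sets (return X q \<Otimes>\<^sub>M N) = sets (X \<Otimes>\<^sub>M N)"
    by (intro sets_pair_measure_cong) auto
  then have "f \<in> borel_measurable (return X q \<Otimes>\<^sub>M N)"
    using f by (simp cong: measurable_cong_sets)
  then have "(\<integral>\<^sup>+z. f z \<partial>(return X q \<Otimes>\<^sub>M N)) = (\<integral>\<^sup>+x. \<integral>\<^sup>+v. f (x, v) \<partial>N \<partial>return X q)"
    by (rule nn_integral_fst[symmetric])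
  also have "\<dots> = (\<integral>\<^sup>+v. f (q, v) \<partial>N)"
    using assms(2) borel_measurable_nn_integral_fst[OF f] by (rule nn_integral_return)
  finally show ?thesis .
qed

section \<open>The measure \<open>Nmeas\<close>: its integrals, and the first marginals of its
  slices\<close>

text \<open>The data behind \<open>Nmeas\<close>, \<open>Rker\<close> and \<open>Emap\<close>,
  together with (H1). The weights \<alpha> enter later, with \<open>Aker\<close>.\<close>

locale involutive_proposals =
  fixes X :: "'a measure" and Y :: "'b measure" and p :: nat
    and V :: "nat \<Rightarrow> 'a \<Rightarrow> 'b measure"
    and S :: "nat \<Rightarrow> 'a \<times> 'b \<Rightarrow> 'a \<times> 'b"
    and \<mu> :: "'a measure"
  assumes V: "\<And>j. j \<le> p \<Longrightarrow> V j \<in> X \<rightarrow>\<^sub>M prob_algebra Y"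
    and S: "\<And>j. j \<le> p \<Longrightarrow> S j \<in> X \<Otimes>\<^sub>M Y \<rightarrow>\<^sub>M X \<Otimes>\<^sub>M Y"
    and \<mu>_prob: "prob_space \<mu>" and \<mu>_sets: "sets \<mu> = sets X"
    and involution: "\<And>j x. j \<le> p \<Longrightarrow> x \<in> space (X \<Otimes>\<^sub>M Y) \<Longrightarrow> S j (S j x) = x"
begin

lemma sets_Mmeas: "j \<le> p \<Longrightarrow> sets (Mmeas X \<mu> V j) = sets (X \<Otimes>\<^sub>M Y)"
  using Mmeas_prob[of \<mu> X V j Y, OF \<mu>_prob \<mu>_sets V] by (simp add: space_prob_algebra)

lemma Nmeas_in_prob_algebra: "Nmeas X Y p \<mu> V S \<in> space (prob_algebra (Zspace X Y p))"
  using \<mu>_prob \<mu>_sets V S by (rule Nmeas_prob)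

lemma sets_Nmeas: "sets (Nmeas X Y p \<mu> V S) = sets (Zspace X Y p)"
  by (simp add: Nmeas_def)

lemma Rker_kernel: "Rker X Y p V S \<in> Zspace X Y p \<rightarrow>\<^sub>M prob_algebra (Zspace X Y p)"
  using V S by (rule Rker_measurable)

lemma slice_measurable:
  assumes "f \<in> Zspace X Y p \<rightarrow>\<^sub>M N" "j \<le> p"
  shows "(\<lambda>x. f (x, j)) \<in> X \<Otimes>\<^sub>M Y \<rightarrow>\<^sub>M N"
  using assms unfolding Zspace_def by (intro measurable_compose[OF _ assms(1)[unfolded Zspace_def]]) simp

lemma slice_S_measurable:
  assumes "f \<in> Zspace X Y p \<rightarrow>\<^sub>M N" "j \<le> p"
  shows "(\<lambda>x. f (S j x, j)) \<in> X \<Otimes>\<^sub>M Y \<rightarrow>\<^sub>M N"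
  using measurable_compose[OF S[OF assms(2)] slice_measurable[OF assms]] .

text \<open>This form keeps the pushforwards under \<open>S j\<close> visible. The balance condition
  in (H2) is stated for them, so this is the form used for \<open>Aker\<close>.\<close>

lemma nn_integral_Nmeas_distr:
  assumes f: "f \<in> borel_measurable (Zspace X Y p)"
  shows "(\<integral>\<^sup>+z. f z \<partial>Nmeas X Y p \<mu> V S)
    = (\<Sum>j\<le>p. ennreal (1 / (real p + 1)) * (\<integral>\<^sup>+x. f (x, j) \<partial>distr (Mmeas X \<mu> V j) (X \<Otimes>\<^sub>M Y) (S j)))"
proof -
  let ?D = "\<lambda>j. distr (Mmeas X \<mu> V j) (X \<Otimes>\<^sub>M Y) (S j)"
  have s: "sets (?D j \<Otimes>\<^sub>M return (count_space {..p}) j) = sets (Zspace X Y p)"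
    "sets (?D j \<Otimes>\<^sub>M count_space {..p}) = sets (Zspace X Y p)" for j
    unfolding Zspace_def by (intro sets_pair_measure_cong; simp)+
  have "(\<integral>\<^sup>+z. f z \<partial>Nmeas X Y p \<mu> V S) = (\<Sum>j\<le>p. ennreal (1 / (real p + 1)) *
      (\<integral>\<^sup>+z. f z \<partial>(?D j \<Otimes>\<^sub>M return (count_space {..p}) j)))"
    unfolding Nmeas_def using f
    by (subst nn_integral_measure_sum)
      (auto simp: s nn_integral_scale_measure cong: measurable_cong_sets)
  also have "\<dots> = (\<Sum>j\<le>p. ennreal (1 / (real p + 1)) * (\<integral>\<^sup>+x. f (x, j) \<partial>?D j))"
    using f by (intro sum.cong refl arg_cong2[where f="(*)"] nn_integral_pair_return)
      (auto simp: s cong: measurable_cong_sets)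
  finally show ?thesis .
qed

text \<open>Change of variables in the previous form. Evaluating \<open>f\<close> at
  \<open>S j x\<close> lets a further \<open>S j\<close> inside \<open>f\<close> cancel by (H1);
  this serves \<open>Rker\<close> and \<open>Emap\<close>.\<close>

lemma nn_integral_Nmeas:
  assumes f: "f \<in> borel_measurable (Zspace X Y p)"
  shows "(\<integral>\<^sup>+z. f z \<partial>Nmeas X Y p \<mu> V S)
    = (\<Sum>j\<le>p. ennreal (1 / (real p + 1)) * (\<integral>\<^sup>+x. f (S j x, j) \<partial>Mmeas X \<mu> V j))"
proof -
  have "(\<integral>\<^sup>+x. f (x, j) \<partial>distr (Mmeas X \<mu> V j) (X \<Otimes>\<^sub>M Y) (S j))
      = (\<integral>\<^sup>+x. f (S j x, j) \<partial>Mmeas X \<mu> V j)" if j: "j \<le> p" for j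
    using S[OF j] slice_measurable[OF f j]
    by (intro nn_integral_distr) (simp_all add: sets_Mmeas[OF j] cong: measurable_cong_sets)
  then show ?thesis
    using f by (simp add: nn_integral_Nmeas_distr)
qed

text \<open>Every \<open>V j q\<close> has total mass one, so integrating out the second coordinate
  leaves the weight of \<open>q\<close> under \<mu> unchanged.\<close>

lemma distr_fst_Mmeas:
  assumes j: "j \<le> p"
  shows "distr (Mmeas X \<mu> V j) X fst = \<mu>"
proof (rule measure_eqI)
  fix A assume "A \<in> sets (distr (Mmeas X \<mu> V j) X fst)"
  then have A: "A \<in> sets X" by simp
  have fst: "fst \<in> Mmeas X \<mu> V j \<rightarrow>\<^sub>M X"
    by (simp add: sets_Mmeas[OF j] cong: measurable_cong_sets)
  have "emeasure (distr (Mmeas X \<mu> V j) X fst) A = emeasure (Mmeas X \<mu> V j) (A \<times> space Y)"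
    using A sets.sets_into_space[OF A] sets_eq_imp_space_eq[OF sets_Mmeas[OF j]]
    by (subst emeasure_distr[OF fst])
      (auto intro!: arg_cong[where f="emeasure _"] simp: space_pair_measure)
  also have "\<dots> = (\<integral>\<^sup>+q. emeasure (V j q) (Pair q -` (A \<times> space Y)) \<partial>\<mu>)"
    using A by (intro emeasure_Mmeas[where Y=Y] \<mu>_prob \<mu>_sets V j) auto
  also have "\<dots> = (\<integral>\<^sup>+q. indicator A q \<partial>\<mu>)"
  proof (rule nn_integral_cong)
    fix q assume "q \<in> space \<mu>"
    then have "q \<in> space X"
      using sets_eq_imp_space_eq[OF \<mu>_sets] by simp
    then have "V j q \<in> space (prob_algebra Y)"
      by (rule measurable_space[OF V[OF j]])
    then have "prob_space (V j q)" "space (V j q) = space Y"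
      by (auto simp: space_prob_algebra dest: sets_eq_imp_space_eq)
    then have "emeasure (V j q) (space Y) = 1"
      using prob_space.emeasure_space_1 by metis
    \<comment> \<open>The fibre over \<open>q\<close> is \<open>space Y\<close> if \<open>q\<close>
      lies in \<open>A\<close>, and empty otherwise.\<close>
    then show "emeasure (V j q) (Pair q -` (A \<times> space Y)) = indicator A q"
      by (simp add: indicator_def vimage_def)
  qed
  also have "\<dots> = emeasure \<mu> A"
    using A \<mu>_sets by simp
  finally show "emeasure (distr (Mmeas X \<mu> V j) X fst) A = emeasure \<mu> A" .
qed (simp add: \<mu>_sets)

section \<open>Invariance under \<open>Rker\<close>\<close>

text \<open>At the transported point \<open>(S k x, k)\<close> the involution turns the base point
  \<open>fst (S k (S k x))\<close> into \<open>fst x\<close>. The value therefore depends on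
  \<open>x\<close> through \<open>fst x\<close> alone, which is what makes integration against
  \<open>Mmeas X \<mu> V k\<close> reduce to integration against \<mu>.\<close>

lemma emeasure_Rker_S:
  assumes k: "k \<le> p" and x: "x \<in> space (X \<Otimes>\<^sub>M Y)" and E: "E \<in> sets (Zspace X Y p)"
  shows "emeasure (Rker X Y p V S (S k x, k)) E
    = emeasure (V k (fst x)) (Pair (fst x) -` {y \<in> space (X \<Otimes>\<^sub>M Y). (S k y, k) \<in> E})"
proof -
  let ?q = "fst x" and ?F = "{y \<in> space (X \<Otimes>\<^sub>M Y). (S k y, k) \<in> E}"
  let ?L = "return X ?q \<Otimes>\<^sub>M V k ?q"
  have q: "?q \<in> space X" using x by (auto simp: space_pair_measure)
  then have Vq: "prob_space (V k ?q)" "sets (V k ?q) = sets Y"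
    using measurable_space[OF V[OF k]] by (auto simp: space_prob_algebra)
  interpret Vq: prob_space "V k ?q" by fact
  have s: "sets ?L = sets (X \<Otimes>\<^sub>M Y)" "sets (X \<Otimes>\<^sub>M V k ?q) = sets (X \<Otimes>\<^sub>M Y)"
    by (intro sets_pair_measure_cong; simp add: Vq)+
  have ind: "indicator E \<in> borel_measurable (Zspace X Y p)"
    using E by (rule borel_measurable_indicator)
  \<comment> \<open>\<open>?F\<close> is the preimage of \<open>E\<close> under the map sending
    \<open>y\<close> to \<open>(S k y, k)\<close>, which is measurable by
    \<open>slice_S_measurable\<close> applied to the identity.\<close>
  have F: "?F \<in> sets (X \<Otimes>\<^sub>M Y)"
    using slice_S_measurable[OF measurable_ident k] E
    by (auto dest: measurable_sets simp: vimage_def Int_def conj_commute)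
  have sD: "sets (distr ?L (X \<Otimes>\<^sub>M Y) (S k) \<Otimes>\<^sub>M count_space {..p}) = sets (Zspace X Y p)"
    "sets (distr ?L (X \<Otimes>\<^sub>M Y) (S k) \<Otimes>\<^sub>M return (count_space {..p}) k) = sets (Zspace X Y p)"
    unfolding Zspace_def by (intro sets_pair_measure_cong; simp)+
  have "Rker X Y p V S (S k x, k) = distr ?L (X \<Otimes>\<^sub>M Y) (S k) \<Otimes>\<^sub>M return (count_space {..p}) k"
    using involution[OF k x] by (simp add: Rker_def split_beta)
  then have "emeasure (Rker X Y p V S (S k x, k)) E
      = (\<integral>\<^sup>+z. indicator E z \<partial>(distr ?L (X \<Otimes>\<^sub>M Y) (S k) \<Otimes>\<^sub>M return (count_space {..p}) k))"
    using E sD by simp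
  also have "\<dots> = (\<integral>\<^sup>+y. indicator E (y, k) \<partial>distr ?L (X \<Otimes>\<^sub>M Y) (S k))"
    using k ind by (intro nn_integral_pair_return) (auto simp: sD cong: measurable_cong_sets)
  also have "\<dots> = (\<integral>\<^sup>+y. indicator E (S k y, k) \<partial>?L)"
    using S[OF k] slice_measurable[OF ind k]
    by (intro nn_integral_distr) (simp_all add: s cong: measurable_cong_sets)
  \<comment> \<open>\<open>?F\<close> contains only points of the product space, so the two
    indicators are compared on the space of \<open>?L\<close>.\<close>
  also have "\<dots> = (\<integral>\<^sup>+y. indicator ?F y \<partial>?L)"
    using sets_eq_imp_space_eq[OF s(1)] by (intro nn_integral_cong) (auto simp: indicator_def)
  also have "\<dots> = (\<integral>\<^sup>+v. indicator ?F (?q, v) \<partial>V k ?q)"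
    using q F by (intro nn_integral_return_pair Vq.sigma_finite_measure_axioms)
      (auto simp: s cong: measurable_cong_sets)
  also have "\<dots> = (\<integral>\<^sup>+v. indicator (Pair ?q -` ?F) v \<partial>V k ?q)"
    by (intro nn_integral_cong) (auto simp: indicator_def)
  also have "\<dots> = emeasure (V k ?q) (Pair ?q -` ?F)"
    using sets_Pair1[OF F, of ?q] Vq by (intro nn_integral_indicator) simp
  finally show ?thesis .
qed

text \<open>\<open>Rker\<close> leaves the index \<open>k\<close> fixed, so it suffices to compare
  the two integrals slice by slice. On slice \<open>k\<close> both equal the
  \<open>Mmeas X \<mu> V k\<close>-measure of the transported set \<open>?F k\<close>.\<close>

lemma bind_Nmeas_Rker: "Nmeas X Y p \<mu> V S \<bind> Rker X Y p V S = Nmeas X Y p \<mu> V S"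
proof (rule measure_eqI)
  show "sets (Nmeas X Y p \<mu> V S \<bind> Rker X Y p V S) = sets (Nmeas X Y p \<mu> V S)"
    using sets_bind'[OF Nmeas_in_prob_algebra Rker_kernel] by (simp add: sets_Nmeas)
  fix E assume "E \<in> sets (Nmeas X Y p \<mu> V S \<bind> Rker X Y p V S)"
  then have E: "E \<in> sets (Zspace X Y p)"
    using sets_bind'[OF Nmeas_in_prob_algebra Rker_kernel] by simp
  let ?F = "\<lambda>k. {y \<in> space (X \<Otimes>\<^sub>M Y). (S k y, k) \<in> E}"
  let ?R = "\<lambda>z. emeasure (Rker X Y p V S z) E"
  have R: "?R \<in> borel_measurable (Zspace X Y p)"
    using measurable_compose[OF measurable_prob_algebraD[OF Rker_kernel] measurable_emeasure_subprob_algebra[OF E]] .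
  have "(\<integral>\<^sup>+x. ?R (S k x, k) \<partial>Mmeas X \<mu> V k) = (\<integral>\<^sup>+x. indicator E (S k x, k) \<partial>Mmeas X \<mu> V k)"
    if k: "k \<le> p" for k
  proof -
    have F: "?F k \<in> sets (X \<Otimes>\<^sub>M Y)"
      using slice_S_measurable[OF measurable_ident k] E
      by (auto dest: measurable_sets simp: vimage_def Int_def conj_commute)
    have spM: "space (Mmeas X \<mu> V k) = space (X \<Otimes>\<^sub>M Y)"
      using sets_Mmeas[OF k] by (rule sets_eq_imp_space_eq)
    have h: "(\<lambda>q. emeasure (V k q) (Pair q -` ?F k)) \<in> borel_measurable X"
    proof (rule emeasure_measurable_subprob_algebra2)
      \<comment> \<open>The fibres reassemble to the whole of \<open>?F k\<close> because it lies
        inside the product space; this gives measurability of the fibre measure in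
        \<open>q\<close>.\<close>
      have "(SIGMA q:space X. Pair q -` ?F k) = ?F k"
        by (auto simp: space_pair_measure)
      then show "(SIGMA q:space X. Pair q -` ?F k) \<in> sets (X \<Otimes>\<^sub>M Y)"
        using F by simp
    qed (rule measurable_prob_algebraD[OF V[OF k]])
    have "(\<integral>\<^sup>+x. ?R (S k x, k) \<partial>Mmeas X \<mu> V k)
        = (\<integral>\<^sup>+x. emeasure (V k (fst x)) (Pair (fst x) -` ?F k) \<partial>Mmeas X \<mu> V k)"
      using k E by (intro nn_integral_cong emeasure_Rker_S) (auto simp: spM)
    \<comment> \<open>The integrand factors through \<open>fst\<close>, so only the first marginal
      matters, and that is \<mu>.\<close>
    also have "\<dots> = (\<integral>\<^sup>+q. emeasure (V k q) (Pair q -` ?F k) \<partial>distr (Mmeas X \<mu> V k) X fst)"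
      using h by (intro nn_integral_distr[symmetric]) (simp_all add: sets_Mmeas[OF k] cong: measurable_cong_sets)
    \<comment> \<open>The disintegration of \<open>Mmeas\<close> read backwards: redrawing the
      second coordinate from \<open>V k q\<close> restores the joint law.\<close>
    also have "\<dots> = emeasure (Mmeas X \<mu> V k) (?F k)"
      unfolding distr_fst_Mmeas[OF k]
      using \<mu>_prob \<mu>_sets V[OF k] F by (rule emeasure_Mmeas[symmetric])
    also have "\<dots> = (\<integral>\<^sup>+x. indicator (?F k) x \<partial>Mmeas X \<mu> V k)"
      using F by (simp add: sets_Mmeas[OF k])
    also have "\<dots> = (\<integral>\<^sup>+x. indicator E (S k x, k) \<partial>Mmeas X \<mu> V k)"
      by (intro nn_integral_cong) (auto simp: indicator_def spM)
    finally show ?thesis .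
  qed
  \<comment> \<open>\<open>nn_integral_indicator\<close> is withheld so that the right-hand side
    remains an integral and \<open>nn_integral_Nmeas\<close> splits both sides into slices.\<close>
  then have "(\<integral>\<^sup>+z. ?R z \<partial>Nmeas X Y p \<mu> V S) = (\<integral>\<^sup>+z. indicator E z \<partial>Nmeas X Y p \<mu> V S)"
    using R E by (simp add: nn_integral_Nmeas del: nn_integral_indicator)
  then show "emeasure (Nmeas X Y p \<mu> V S \<bind> Rker X Y p V S) E = emeasure (Nmeas X Y p \<mu> V S) E"
    using E emeasure_bind_prob_algebra[OF Nmeas_in_prob_algebra Rker_kernel E] by (simp add: sets_Nmeas)
qed

section \<open>The image of \<open>Nmeas\<close> under \<open>Emap\<close>\<close>

lemma Emap_measurable: "Emap S \<in> Zspace X Y p \<rightarrow>\<^sub>M X"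
  using S by (intro measurable_Zspace_split) (auto simp: Emap_def split_beta intro: measurable_compose)

text \<open>By (H1), \<open>Emap S (S j x, j)\<close> is \<open>fst x\<close>, so each slice
  contributes its weight times the first marginal \<mu>.\<close>

lemma distr_Nmeas_Emap: "distr (Nmeas X Y p \<mu> V S) X (Emap S) = \<mu>"
proof (rule measure_eqI)
  fix A assume "A \<in> sets (distr (Nmeas X Y p \<mu> V S) X (Emap S))"
  then have A: "A \<in> sets X" by simp
  have Em: "Emap S \<in> Nmeas X Y p \<mu> V S \<rightarrow>\<^sub>M X"
    using Emap_measurable by (simp add: sets_Nmeas cong: measurable_cong_sets)
  have "(\<integral>\<^sup>+x. indicator A (Emap S (S j x, j)) \<partial>Mmeas X \<mu> V j) = emeasure \<mu> A" if j: "j \<le> p" for j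
  proof -
    have "(\<integral>\<^sup>+x. indicator A (Emap S (S j x, j)) \<partial>Mmeas X \<mu> V j)
        = (\<integral>\<^sup>+x. indicator A (fst x) \<partial>Mmeas X \<mu> V j)"
      using involution[OF j] sets_eq_imp_space_eq[OF sets_Mmeas[OF j]]
      by (intro nn_integral_cong) (simp add: Emap_def split_beta)
    also have "\<dots> = (\<integral>\<^sup>+q. indicator A q \<partial>distr (Mmeas X \<mu> V j) X fst)"
      using A by (intro nn_integral_distr[symmetric]) (simp_all add: sets_Mmeas[OF j] cong: measurable_cong_sets)
    also have "\<dots> = emeasure \<mu> A"
      unfolding distr_fst_Mmeas[OF j] using A \<mu>_sets by simp
    finally show ?thesis .
  qed
  then have *: "(\<integral>\<^sup>+z. indicator A (Emap S z) \<partial>Nmeas X Y p \<mu> V S)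
      = (\<Sum>j\<le>p. ennreal (1 / (real p + 1)) * emeasure \<mu> A)"
    using A Emap_measurable by (subst nn_integral_Nmeas) auto
  \<comment> \<open>The indices run from 0 to \<open>p\<close>, hence there are \<open>p + 1\<close>
    equal weights.\<close>
  have c: "(\<Sum>j\<le>p. ennreal (1 / (real p + 1))) = 1"
    by (subst sum_ennreal) auto
  have "emeasure (distr (Nmeas X Y p \<mu> V S) X (Emap S)) A
      = (\<integral>\<^sup>+z. indicator A (Emap S z) \<partial>Nmeas X Y p \<mu> V S)"
    using A Em nn_integral_distr[OF Em, of "indicator A"] by simp
  then show "emeasure (distr (Nmeas X Y p \<mu> V S) X (Emap S)) A = emeasure \<mu> A"
    unfolding * sum_distrib_right[symmetric] c by simp
qed (simp add: \<mu>_sets)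

end

section \<open>Invariance under \<open>Aker\<close>\<close>

lemma emeasure_Aker:
  assumes k: "k \<le> p" and x: "x \<in> space (X \<Otimes>\<^sub>M Y)" and E: "E \<in> sets (Zspace X Y p)"
  shows "emeasure (Aker X Y p \<alpha> (x, k)) E = (\<Sum>j\<le>p. ennreal (\<alpha> k j x) * indicator E (x, j))"
proof -
  let ?C = "count_space {..p}"
  let ?s = "measure_sum ?C {..p} (\<lambda>j. scale_measure (ennreal (\<alpha> k j x)) (return ?C j))"
  have A: "Aker X Y p \<alpha> (x, k) = return (X \<Otimes>\<^sub>M Y) x \<Otimes>\<^sub>M ?s"
    by (cases x) (simp add: Aker_def)
  \<comment> \<open>Finitely many finite weights give a finite measure, hence the sigma-finiteness
    that \<open>nn_integral_return_pair\<close> asks for.\<close>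
  have "emeasure ?s (space ?s) < \<infinity>"
    by (subst emeasure_measure_sum) (auto simp: ennreal_mult_less_top)
  then interpret finite_measure ?s
    by (intro finite_measureI) auto
  have s: "sets (return (X \<Otimes>\<^sub>M Y) x \<Otimes>\<^sub>M ?s) = sets (Zspace X Y p)"
    "sets ((X \<Otimes>\<^sub>M Y) \<Otimes>\<^sub>M ?s) = sets (Zspace X Y p)"
    unfolding Zspace_def by (intro sets_pair_measure_cong; simp)+
  have "emeasure (Aker X Y p \<alpha> (x, k)) E = (\<integral>\<^sup>+z. indicator E z \<partial>(return (X \<Otimes>\<^sub>M Y) x \<Otimes>\<^sub>M ?s))"
    using E s A by simp
  also have "\<dots> = (\<integral>\<^sup>+j. indicator E (x, j) \<partial>?s)"
    using x E by (intro nn_integral_return_pair sigma_finite_measure_axioms)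
      (auto simp: s cong: measurable_cong_sets)
  also have "\<dots> = (\<Sum>j\<le>p. ennreal (\<alpha> k j x) * indicator E (x, j))"
    by (subst nn_integral_measure_sum)
      (auto simp: nn_integral_scale_measure nn_integral_return intro!: sum.cong)
  finally show ?thesis .
qed

text \<open>\<open>Aker\<close> keeps \<open>x\<close> and moves mass between slices. What arrives
  in slice \<open>j\<close> is the \<alpha>-weighted sum of all pushforwards, and
  \<open>balance\<close> identifies it with the pushforward already there. The common factor
  \<open>1 / (p + 1)\<close> passes through unchanged.\<close>

lemma (in involutive_proposals) bind_Nmeas_Aker:
  assumes \<alpha>_measurable: "\<And>k j. k \<le> p \<Longrightarrow> j \<le> p \<Longrightarrow> \<alpha> k j \<in> borel_measurable (X \<Otimes>\<^sub>M Y)"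
    and A_kernel: "Aker X Y p \<alpha> \<in> Zspace X Y p \<rightarrow>\<^sub>M prob_algebra (Zspace X Y p)"
    and balance: "\<And>j. j \<le> p \<Longrightarrow>
      distr (Mmeas X \<mu> V j) (X \<Otimes>\<^sub>M Y) (S j)
        = measure_sum (X \<Otimes>\<^sub>M Y) {..p}
            (\<lambda>k. density (distr (Mmeas X \<mu> V k) (X \<Otimes>\<^sub>M Y) (S k)) (\<lambda>x. ennreal (\<alpha> k j x)))"
  shows "Nmeas X Y p \<mu> V S \<bind> Aker X Y p \<alpha> = Nmeas X Y p \<mu> V S"
proof (rule measure_eqI)
  show "sets (Nmeas X Y p \<mu> V S \<bind> Aker X Y p \<alpha>) = sets (Nmeas X Y p \<mu> V S)"
    using sets_bind'[OF Nmeas_in_prob_algebra A_kernel] by (simp add: sets_Nmeas)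
  fix E assume "E \<in> sets (Nmeas X Y p \<mu> V S \<bind> Aker X Y p \<alpha>)"
  then have E: "E \<in> sets (Zspace X Y p)"
    using sets_bind'[OF Nmeas_in_prob_algebra A_kernel] by simp
  let ?c = "ennreal (1 / (real p + 1))" and ?D = "\<lambda>k. distr (Mmeas X \<mu> V k) (X \<Otimes>\<^sub>M Y) (S k)"
  let ?A = "\<lambda>z. emeasure (Aker X Y p \<alpha> z) E"
  have A: "?A \<in> borel_measurable (Zspace X Y p)"
    using measurable_compose[OF measurable_prob_algebraD[OF A_kernel] measurable_emeasure_subprob_algebra[OF E]] .
  have ind: "indicator E \<in> borel_measurable (Zspace X Y p)"
    using E by (rule borel_measurable_indicator)
  have "(\<integral>\<^sup>+x. ?A (x, k) \<partial>?D k) = (\<Sum>j\<le>p. \<integral>\<^sup>+x. ennreal (\<alpha> k j x) * indicator E (x, j) \<partial>?D k)"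
    if k: "k \<le> p" for k
  proof -
    have "(\<integral>\<^sup>+x. ?A (x, k) \<partial>?D k) = (\<integral>\<^sup>+x. (\<Sum>j\<le>p. ennreal (\<alpha> k j x) * indicator E (x, j)) \<partial>?D k)"
      using k E by (intro nn_integral_cong emeasure_Aker) auto
    also have "\<dots> = (\<Sum>j\<le>p. \<integral>\<^sup>+x. ennreal (\<alpha> k j x) * indicator E (x, j) \<partial>?D k)"
      using \<alpha>_measurable[OF k] slice_measurable[OF ind]
      by (intro nn_integral_sum borel_measurable_times_ennreal) auto
    finally show ?thesis .
  qed
  then have "(\<integral>\<^sup>+z. ?A z \<partial>Nmeas X Y p \<mu> V S)
      = (\<Sum>k\<le>p. \<Sum>j\<le>p. ?c * (\<integral>\<^sup>+x. ennreal (\<alpha> k j x) * indicator E (x, j) \<partial>?D k))"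
    using A by (simp add: nn_integral_Nmeas_distr sum_distrib_left)
  \<comment> \<open>Regroup by the target index \<open>j\<close> instead of the source index
    \<open>k\<close>, so that the inner sum is the mass arriving in slice \<open>j\<close>.\<close>
  also have "\<dots> = (\<Sum>j\<le>p. ?c * (\<Sum>k\<le>p. \<integral>\<^sup>+x. ennreal (\<alpha> k j x) * indicator E (x, j) \<partial>?D k))"
    by (subst sum.swap) (simp add: sum_distrib_left)
  also have "\<dots> = (\<Sum>j\<le>p. ?c * (\<integral>\<^sup>+x. indicator E (x, j) \<partial>?D j))"
  proof (intro sum.cong refl arg_cong2[where f="(*)"])
    fix j assume "j \<in> {..p}"
    then have j: "j \<le> p" by simp
    \<comment> \<open>Here \<open>balance\<close> enters: it replaces \<open>?D j\<close> by the sum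
      of densities.\<close>
    have "(\<integral>\<^sup>+x. indicator E (x, j) \<partial>?D j)
        = (\<Sum>k\<le>p. \<integral>\<^sup>+x. indicator E (x, j) \<partial>density (?D k) (\<lambda>x. ennreal (\<alpha> k j x)))"
      using slice_measurable[OF ind j]
      by (subst balance[OF j], subst nn_integral_measure_sum) auto
    also have "\<dots> = (\<Sum>k\<le>p. \<integral>\<^sup>+x. ennreal (\<alpha> k j x) * indicator E (x, j) \<partial>?D k)"
      using slice_measurable[OF ind j] \<alpha>_measurable[OF _ j]
      by (intro sum.cong refl nn_integral_density) auto
    finally show "(\<Sum>k\<le>p. \<integral>\<^sup>+x. ennreal (\<alpha> k j x) * indicator E (x, j) \<partial>?D k)
        = (\<integral>\<^sup>+x. indicator E (x, j) \<partial>?D j)" ..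
  qed
  also have "\<dots> = (\<integral>\<^sup>+z. indicator E z \<partial>Nmeas X Y p \<mu> V S)"
    using ind by (rule nn_integral_Nmeas_distr[symmetric])
  finally show "emeasure (Nmeas X Y p \<mu> V S \<bind> Aker X Y p \<alpha>) E = emeasure (Nmeas X Y p \<mu> V S) E"
    using E emeasure_bind_prob_algebra[OF Nmeas_in_prob_algebra A_kernel E] by (simp add: sets_Nmeas)
qed

section \<open>Invariance under \<open>Pker\<close> and its consequences\<close>

text \<open>\<open>Pker\<close> at \<open>n\<close> is one application of \<open>Rker\<close>
  followed by \<open>n\<close> of \<open>Aker\<close>, and \<nu> is fixed by each. The induction
  starts at 0, where \<open>Pker\<close> is \<open>Rker\<close> by convention.\<close>

lemma bind_Pker_invariant:
  assumes \<nu>: "sets \<nu> = sets (Zspace X Y p)"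
    and R: "Rker X Y p V S \<in> Zspace X Y p \<rightarrow>\<^sub>M prob_algebra (Zspace X Y p)"
    and A: "Aker X Y p \<alpha> \<in> Zspace X Y p \<rightarrow>\<^sub>M prob_algebra (Zspace X Y p)"
    and "\<nu> \<bind> Rker X Y p V S = \<nu>" "\<nu> \<bind> Aker X Y p \<alpha> = \<nu>"
  shows "\<nu> \<bind> Pker X Y p V S \<alpha> n = \<nu>"
proof (induction n)
  case (Suc n)
  have P: "Pker X Y p V S \<alpha> n \<in> \<nu> \<rightarrow>\<^sub>M subprob_algebra (Zspace X Y p)"
    using Pker_measurable[OF R A] \<nu> by (auto intro: measurable_prob_algebraD cong: measurable_cong_sets)
  \<comment> \<open>Associativity of composition exposes \<nu> followed by \<open>Pker\<close> at
    \<open>n\<close>, to which the induction hypothesis applies.\<close>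
  have "\<nu> \<bind> Pker X Y p V S \<alpha> (Suc n) = \<nu> \<bind> Pker X Y p V S \<alpha> n \<bind> Aker X Y p \<alpha>"
    using bind_assoc[OF P measurable_prob_algebraD[OF A]] by simp
  then show ?case
    using Suc assms(5) by simp
qed (simp add: assms(4))

theorem theorem3p3:
  fixes X :: "'a measure" and Y :: "'b measure" and p :: nat
    and V :: "nat \<Rightarrow> 'a \<Rightarrow> 'b measure"
    and S :: "nat \<Rightarrow> 'a \<times> 'b \<Rightarrow> 'a \<times> 'b"
    and \<alpha> :: "nat \<Rightarrow> nat \<Rightarrow> 'a \<times> 'b \<Rightarrow> real"
    and \<mu> :: "'a measure"
  assumes p: "p \<ge> 1"
    and V: "\<And>j. j \<le> p \<Longrightarrow> V j \<in> X \<rightarrow>\<^sub>M prob_algebra Y"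
    and S: "\<And>j. j \<le> p \<Longrightarrow> S j \<in> X \<Otimes>\<^sub>M Y \<rightarrow>\<^sub>M X \<Otimes>\<^sub>M Y"
    and \<alpha>_measurable: "\<And>k j. k \<le> p \<Longrightarrow> j \<le> p \<Longrightarrow> \<alpha> k j \<in> borel_measurable (X \<Otimes>\<^sub>M Y)"
    and \<alpha>_range: "\<And>k j x. k \<le> p \<Longrightarrow> j \<le> p \<Longrightarrow> x \<in> space (X \<Otimes>\<^sub>M Y) \<Longrightarrow> \<alpha> k j x \<in> {0..1}"
    and \<mu>_prob: "prob_space \<mu>" and \<mu>_sets: "sets \<mu> = sets X"
    and H1: "\<And>j x. j \<le> p \<Longrightarrow> x \<in> space (X \<Otimes>\<^sub>M Y) \<Longrightarrow> S j (S j x) = x"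
    and H2_sum: "\<And>k x. k \<le> p \<Longrightarrow> x \<in> space (X \<Otimes>\<^sub>M Y) \<Longrightarrow> (\<Sum>j\<le>p. \<alpha> k j x) = 1"
    and H2: "\<And>j. j \<le> p \<Longrightarrow>
      distr (Mmeas X \<mu> V j) (X \<Otimes>\<^sub>M Y) (S j)
        = measure_sum (X \<Otimes>\<^sub>M Y) {..p}
            (\<lambda>k. density (distr (Mmeas X \<mu> V k) (X \<Otimes>\<^sub>M Y) (S k)) (\<lambda>x. ennreal (\<alpha> k j x)))"
  shows "Nmeas X Y p \<mu> V S \<bind> Rker X Y p V S = Nmeas X Y p \<mu> V S
    \<and> Nmeas X Y p \<mu> V S \<bind> Aker X Y p \<alpha> = Nmeas X Y p \<mu> V S
    \<and> (\<forall>n\<ge>1. Nmeas X Y p \<mu> V S \<bind> Pker X Y p V S \<alpha> n = Nmeas X Y p \<mu> V S)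
    \<and> distr (Nmeas X Y p \<mu> V S) X (Emap S) = \<mu>
    \<and> (\<forall>n\<ge>1. distr (Nmeas X Y p \<mu> V S \<bind> Pker X Y p V S \<alpha> n) X (Emap S) = \<mu>)"
proof -
  interpret involutive_proposals X Y p V S \<mu>
    using V S \<mu>_prob \<mu>_sets H1 by (rule involutive_proposals.intro)
  \<comment> \<open>The range of \<alpha> makes the weights nonnegative and \<open>H2_sum\<close>
    gives them total mass one.\<close>
  have A_kernel: "Aker X Y p \<alpha> \<in> Zspace X Y p \<rightarrow>\<^sub>M prob_algebra (Zspace X Y p)"
    using \<alpha>_measurable \<alpha>_range H2_sum by (intro Aker_measurable) auto
  have A: "Nmeas X Y p \<mu> V S \<bind> Aker X Y p \<alpha> = Nmeas X Y p \<mu> V S"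
    using \<alpha>_measurable A_kernel H2 by (rule bind_Nmeas_Aker)
  have "Nmeas X Y p \<mu> V S \<bind> Pker X Y p V S \<alpha> n = Nmeas X Y p \<mu> V S" for n
    using sets_Nmeas Rker_kernel A_kernel bind_Nmeas_Rker A by (rule bind_Pker_invariant)
  \<comment> \<open>Since \<open>Pker\<close> fixes \<open>Nmeas\<close>, the last claim is again
    about the image of \<open>Nmeas\<close> itself under \<open>Emap\<close>.\<close>
  then show ?thesis
    using bind_Nmeas_Rker A distr_Nmeas_Emap by simp
qed

end
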